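(* Let $w\in\mathbb{Z}^n$, $b\in\mathbb{Z}$, and let $f(X)=\mathbb{1}\{w^TX\ge b\}$ for $X\in\{0,1\}^n$ be non-constant. Then $f$ has an NN representation with $2$ anchors whose resolution is $O(RES(w))$. In general, every non-constant $n$-input linear threshold function has a $2$-anchor NN representation with resolution $O(n\log n)$.
   Context: $d$ is Euclidean distance. An NN representation of a Boolean function $f:\{0,1\}^n\to\{0,1\}$ is a pair of disjoint finite sets $P,N\subset\mathbb{R}^n$ (anchors) such that for every $X$ with $f(X)=1$ there is $p\in P$ with $d(X,p)<d(X,q)$ for all $q\in N$, and for every $X$ with $f(X)=0$ there is $q\in N$ with $d(X,q)<d(X,p)$ for all $p\in P$. A linear threshold function is a function of the form $\mathbb{1}\{w^TX\ge b\}$ with $w\in\mathbb{Z}^n$, $b\in\mathbb{Z}$. The resolution of a rational $a/b$ ($a,b\in\mathbb{Z}$ coprime, $b\ne0$) is $RES(a/b)=\lceil\max\{\log_2|a+1|,\log_2|b+1|\}\rceil$; for a rational vector or matrix it is the maximum resolution of its entries; the resolution of an NN representation is the resolution of its anchor matrix (the matrix whose rows are the anchors). *)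

theory Defs
  imports
    "HOL-Analysis.L2_Norm"
    "HOL-Analysis.Abstract_Topology_2"
    "HOL-Library.Landau_Symbols"
    "Jordan_Normal_Form.Matrix"
begin

text \<open>The cube \<open>{0,1}\<^sup>n\<close> is \<^term>\<open>carrier_vec n :: bool vec set\<close>; \<open>bits X\<close> reads a point of it
  as a 0/1 vector over an arbitrary ring.\<close>

definition bits :: "bool vec \<Rightarrow> 'a :: zero_neq_one vec" where
  "bits X = map_vec of_bool X"

definition euclid_dist :: "real vec \<Rightarrow> real vec \<Rightarrow> real" where
  "euclid_dist x y = L2_set (\<lambda>i. x $ i - y $ i) {..<dim_vec x}"

definition nn_representation ::
    "nat \<Rightarrow> (bool vec \<Rightarrow> bool) \<Rightarrow> real vec set \<Rightarrow> real vec set \<Rightarrow> bool" where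
  "nn_representation n f P N \<longleftrightarrow>
     finite P \<and> finite N \<and> P \<subseteq> carrier_vec n \<and> N \<subseteq> carrier_vec n \<and> P \<inter> N = {} \<and>
     (\<forall>X \<in> carrier_vec n. f X \<longrightarrow>
        (\<exists>p\<in>P. \<forall>q\<in>N. euclid_dist (bits X) p < euclid_dist (bits X) q)) \<and>
     (\<forall>X \<in> carrier_vec n. \<not> f X \<longrightarrow>
        (\<exists>q\<in>N. \<forall>p\<in>P. euclid_dist (bits X) q < euclid_dist (bits X) p))"

definition threshold_fun :: "int vec \<Rightarrow> int \<Rightarrow> bool vec \<Rightarrow> bool" where
  "threshold_fun w b X \<longleftrightarrow> w \<bullet> bits X \<ge> b"

definition linear_threshold_function :: "nat \<Rightarrow> (bool vec \<Rightarrow> bool) \<Rightarrow> bool" where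
  "linear_threshold_function n f \<longleftrightarrow>
     (\<exists>w \<in> carrier_vec n. \<exists>b. \<forall>X \<in> carrier_vec n. f X = threshold_fun w b X)"

text \<open>\<^const>\<open>quotient_of\<close> yields the coprime representation \<open>a / b\<close> with \<open>b > 0\<close>.  For
  \<open>a = -1\<close> the first logarithm would be \<open>-\<infinity>\<close>; HOL's convention \<open>log 2 0 = 0\<close> gives the same maximum,
  since \<open>log 2 (b + 1) \<ge> 1\<close>.\<close>

definition res :: "rat \<Rightarrow> int" where
  "res q = (case quotient_of q of (a, b) \<Rightarrow>
     \<lceil>max (log 2 \<bar>real_of_int (a + 1)\<bar>) (log 2 \<bar>real_of_int (b + 1)\<bar>)\<rceil>)"

definition res_vec :: "rat vec \<Rightarrow> int" where
  "res_vec v = Max (res ` set\<^sub>v v)"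

definition res_mat :: "rat mat \<Rightarrow> int" where
  "res_mat A = Max (res ` elements_mat A)"

text \<open>The rows of \<open>A\<close> are the anchors, each listed once (in any order).  Resolution is only defined for
  rational anchors, so the anchor matrix is rational.\<close>

definition anchor_matrix :: "nat \<Rightarrow> real vec set \<Rightarrow> real vec set \<Rightarrow> rat mat \<Rightarrow> bool" where
  "anchor_matrix n P N A \<longleftrightarrow>
     A \<in> carrier_mat (card (P \<union> N)) n \<and> set (rows (map_mat real_of_rat A)) = P \<union> N"

end

theory Submission
  imports Defs "Jordan_Normal_Form.Determinant"
begin

text \<open>Take the anchors \<open>m + w\<close> and \<open>m - w\<close>: their bisector is the hyperplane \<open>w \<bullet> x = w \<bullet> m\<close>, so
  it suffices that \<open>w \<bullet> m = b - 1/2\<close>. A non-constant \<open>f\<close> changes its value along some edge of the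
  cube, and the edge contains such a point \<open>m\<close>; its only coordinate that is not a bit is a fraction
  with denominator \<open>2 * w $ i\<close>. Hence the resolution is bounded in terms of \<open>max \<bar>w $ i\<bar>\<close> only,
  independently of \<open>n\<close> and \<open>b\<close>.

  For the second bound, the weights and thresholds \<open>y = (w, \<theta>)\<close> that realise \<open>f\<close> with margin 1 form
  the polyhedron given by the inequalities \<open>\<plusminus>(X, -1) \<bullet> y \<ge> 1\<close>. By Cramer's rule, multiplying a
  vertex of it by a nonzero determinant of size \<open>n + 1\<close> with entries \<open>0, 1, -1\<close> yields integral
  weights of absolute value at most \<open>(n + 1)!\<close>.\<close>

lemma abs_det_le_fact:
  fixes M :: "'a :: linordered_idom mat"
  assumes "M \<in> carrier_mat n n"
    and entry: "\<And>i j. i < n \<Longrightarrow> j < n \<Longrightarrow> \<bar>M $$ (i, j)\<bar> \<le> 1"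
  shows "\<bar>det M\<bar> \<le> fact n"
proof -
  have "\<bar>signof p * (\<Prod>i = 0..<n. M $$ (i, p i))\<bar> \<le> 1" if "p permutes {0..<n}" for p
  proof -
    have "\<bar>signof p * (\<Prod>i = 0..<n. M $$ (i, p i))\<bar> = (\<Prod>i = 0..<n. \<bar>M $$ (i, p i)\<bar>)"
      by (simp add: abs_mult sign_def abs_prod)
    also have "\<dots> \<le> 1"
      by (rule prod_le_1) (use that entry in \<open>auto simp: permutes_in_image\<close>)
    finally show ?thesis .
  qed
  then have "\<bar>det M\<bar> \<le> (\<Sum>p | p permutes {0..<n}. 1)"
    unfolding det_def'[OF assms(1)] by (intro order.trans[OF sum_abs] sum_mono) auto
  then show ?thesis
    by (simp add: card_permutations of_nat_fact)
qed

lemma det_in_Ints: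
  assumes "M \<in> carrier_mat n n" and "\<And>i j. i < n \<Longrightarrow> j < n \<Longrightarrow> M $$ (i, j) \<in> \<int>"
  shows "det M \<in> \<int>"
  unfolding det_def'[OF assms(1)]
  using assms(2) by (intro Ints_sum Ints_mult Ints_prod) (auto simp: permutes_in_image sign_def)

lemma cofactor_integral_le_fact:
  fixes M :: "'a :: linordered_idom mat"
  assumes M: "M \<in> carrier_mat n n"
    and entry: "\<And>i j. i < n \<Longrightarrow> j < n \<Longrightarrow> M $$ (i, j) \<in> \<int> \<and> \<bar>M $$ (i, j)\<bar> \<le> 1"
  shows "cofactor M i j \<in> \<int> \<and> \<bar>cofactor M i j\<bar> \<le> fact (n - 1)"
proof -
  have D: "mat_delete M i j \<in> carrier_mat (n - 1) (n - 1)"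
    using M by (simp add: mat_delete_def)
  have E: "mat_delete M i j $$ (k, l) \<in> \<int> \<and> \<bar>mat_delete M i j $$ (k, l)\<bar> \<le> 1"
    if "k < n - 1" "l < n - 1" for k l
  proof -
    have "mat_delete M i j $$ (k, l) =
        M $$ (if k < i then k else Suc k, if l < j then l else Suc l)"
      using that M by (simp add: mat_delete_def)
    then show ?thesis
      using that entry by simp
  qed
  have "det (mat_delete M i j) \<in> \<int>"
    using det_in_Ints[OF D] E by blast
  moreover have "\<bar>det (mat_delete M i j)\<bar> \<le> fact (n - 1)"
    using abs_det_le_fact[OF D] E by blast
  ultimately show ?thesis
    by (simp add: cofactor_def abs_mult Ints_mult Ints_power)
qed

lemma det_smult_solution_bound:
  fixes M :: "'a :: linordered_field mat"
  assumes M: "M \<in> carrier_mat n n" and y: "y \<in> carrier_vec n"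
    and entry: "\<And>i j. i < n \<Longrightarrow> j < n \<Longrightarrow> M $$ (i, j) \<in> \<int> \<and> \<bar>M $$ (i, j)\<bar> \<le> 1"
    and sol: "M *\<^sub>v y = vec n (\<lambda>_. 1)" and i: "i < n"
  shows "det M * y $ i \<in> \<int> \<and> \<bar>det M * y $ i\<bar> \<le> fact n"
proof -
  have adj: "adj_mat M \<in> carrier_mat n n"
    using adj_mat(1)[OF M] .
  have "adj_mat M *\<^sub>v (M *\<^sub>v y) = det M \<cdot>\<^sub>v y"
    using adj M y adj_mat(3)[OF M]
    by (subst assoc_mult_mat_vec[symmetric, of _ n n _ n]) auto
  then have "(adj_mat M *\<^sub>v vec n (\<lambda>_. 1)) $ i = det M * y $ i"
    using sol y i by simp
  then have eq: "det M * y $ i = (\<Sum>j<n. cofactor M j i)"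
    using M i by (simp add: adj_mat_def scalar_prod_def atLeast0LessThan)
  note cofactor = cofactor_integral_le_fact[OF M entry]
  have "det M * y $ i \<in> \<int>"
    unfolding eq using cofactor by (intro Ints_sum) simp
  moreover have "\<bar>det M * y $ i\<bar> \<le> (\<Sum>j<n. fact (n - 1))"
    unfolding eq using cofactor by (intro order.trans[OF sum_abs] sum_mono) simp
  moreover have "(\<Sum>j<n. fact (n - 1)) = (fact n :: 'a)"
    using i by (simp add: fact_reduce[of n])
  ultimately show ?thesis by simp
qed

lemma exists_orthogonal_vec:
  fixes a :: "nat \<Rightarrow> 'a :: field vec"
  assumes "k < m" and a: "\<And>i. i < k \<Longrightarrow> a i \<in> carrier_vec m"
  obtains d where "d \<in> carrier_vec m" "d \<noteq> 0\<^sub>v m" "\<And>i. i < k \<Longrightarrow> a i \<bullet> d = 0"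
proof -
  define c where "c i = (if i < k then a i else 0\<^sub>v m)" for i
  define M where "M = mat\<^sub>r m m (\<lambda>i. if i = k then 0\<^sub>v m else c i)"
  have M: "M \<in> carrier_mat m m"
    by (simp add: M_def)
  have row: "row M i = a i" if "i < k" for i
    unfolding M_def using that a assms(1) by (auto simp: c_def)
  have "det M = 0"
    unfolding M_def by (rule det_row_0[OF assms(1)]) (use a in \<open>auto simp: c_def\<close>)
  then obtain d where d: "d \<in> carrier_vec m" "d \<noteq> 0\<^sub>v m" "M *\<^sub>v d = 0\<^sub>v m"
    using det_0_iff_vec_prod_zero_field[OF M] by blast
  have "a i \<bullet> d = 0" if "i < k" for i
  proof -
    have "(M *\<^sub>v d) $ i = row M i \<bullet> d"
      using M that assms(1) by simp
    then show ?thesis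
      using row[of i] d(3) that assms(1) by simp
  qed
  with d that show thesis by blast
qed

text \<open>The ray test: walking from \<open>y\<close> in the direction \<open>d\<close>, stop at the first constraint that
  becomes tight.\<close>

lemma exists_tight_on_ray:
  fixes S :: "'a :: linordered_field vec set"
  assumes "finite S" and S: "S \<subseteq> carrier_vec m" and y: "y \<in> carrier_vec m" and d: "d \<in> carrier_vec m"
    and feas: "\<And>s. s \<in> S \<Longrightarrow> 1 \<le> s \<bullet> y" and neg: "s0 \<in> S" "s0 \<bullet> d < 0"
  obtains s t where "s \<in> S" "s \<bullet> d < 0" "s \<bullet> (y + t \<cdot>\<^sub>v d) = 1"
    "\<forall>s'\<in>S. 1 \<le> s' \<bullet> (y + t \<cdot>\<^sub>v d)"
proof -
  define T where "T = {s \<in> S. s \<bullet> d < 0}"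
  define r where "r s = (s \<bullet> y - 1) / - (s \<bullet> d)" for s
  have T: "finite T" "T \<noteq> {}"
    using assms unfolding T_def by auto
  obtain s where s: "s \<in> T" and min: "\<And>s'. s' \<in> T \<Longrightarrow> r s \<le> r s'"
    using arg_min_if_finite(1)[OF T, of r] arg_min_least[OF T, of _ r] by blast
  have val: "s' \<bullet> (y + r s \<cdot>\<^sub>v d) = s' \<bullet> y + r s * (s' \<bullet> d)" if "s' \<in> S" for s'
    using that S y d by (subst scalar_prod_add_distrib[of _ m]) auto
  have "r s \<ge> 0"
    using s feas[of s] unfolding T_def r_def by (intro divide_nonneg_nonneg) auto
  show thesis
  proof (rule that[of s "r s"])
    show "s \<in> S" "s \<bullet> d < 0"
      using s by (auto simp: T_def)
    then show "s \<bullet> (y + r s \<cdot>\<^sub>v d) = 1"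
      by (simp add: val) (simp add: r_def)
    show "\<forall>s'\<in>S. 1 \<le> s' \<bullet> (y + r s \<cdot>\<^sub>v d)"
    proof
      fix s' assume s': "s' \<in> S"
      show "1 \<le> s' \<bullet> (y + r s \<cdot>\<^sub>v d)"
      proof (cases "s' \<bullet> d < 0")
        case True
        then have "r s \<le> r s'"
          using min s' by (simp add: T_def)
        then have "r s * - (s' \<bullet> d) \<le> s' \<bullet> y - 1"
          unfolding r_def[of s'] using True by (simp only: pos_le_divide_eq neg_0_less_iff_less)
        then show ?thesis
          using val[OF s'] by simp
      next
        case False
        then have "0 \<le> r s * (s' \<bullet> d)"
          using \<open>r s \<ge> 0\<close> by simp
        then show ?thesis
          using val[OF s'] feas[OF s'] by simp
      qed
    qed
  qed
qed

text \<open>Keeping the directions \<open>d j\<close> makes the product of the tight rows with them lower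
  triangular, which is how the tight rows are seen to be independent.\<close>

lemma exists_tight_triangular_system:
  fixes S :: "'a :: linordered_field vec set"
  assumes "finite S" and S: "S \<subseteq> carrier_vec m" and "y0 \<in> carrier_vec m"
    and "\<And>s. s \<in> S \<Longrightarrow> 1 \<le> s \<bullet> y0"
    and span: "\<And>d. d \<in> carrier_vec m \<Longrightarrow> (\<And>s. s \<in> S \<Longrightarrow> s \<bullet> d = 0) \<Longrightarrow> d = 0\<^sub>v m"
    and "k \<le> m"
  shows "\<exists>y a d. y \<in> carrier_vec m \<and> (\<forall>s\<in>S. 1 \<le> s \<bullet> y) \<and>
    (\<forall>i<k. a i \<in> S \<and> d i \<in> carrier_vec m \<and> a i \<bullet> y = 1 \<and> a i \<bullet> d i \<noteq> 0) \<and>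
    (\<forall>i j. i < j \<longrightarrow> j < k \<longrightarrow> a i \<bullet> d j = 0)"
  using \<open>k \<le> m\<close>
proof (induction k)
  case 0
  show ?case
    using assms(3,4) by (intro exI[of _ y0]) auto
next
  case (Suc k)
  then obtain y a d where y: "y \<in> carrier_vec m" "\<forall>s\<in>S. 1 \<le> s \<bullet> y"
    and ad: "\<forall>i<k. a i \<in> S \<and> d i \<in> carrier_vec m \<and> a i \<bullet> y = 1 \<and> a i \<bullet> d i \<noteq> 0"
    and tri: "\<forall>i j. i < j \<longrightarrow> j < k \<longrightarrow> a i \<bullet> d j = 0"
    by auto
  obtain e where e: "e \<in> carrier_vec m" "e \<noteq> 0\<^sub>v m" "\<And>i. i < k \<Longrightarrow> a i \<bullet> e = 0"
    using exists_orthogonal_vec[of k m a] Suc.prems ad S by (metis Suc_le_lessD subsetD)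
  then obtain s0 where s0: "s0 \<in> S" "s0 \<bullet> e \<noteq> 0"
    using span by blast
  obtain f where f: "f \<in> carrier_vec m" "\<And>i. i < k \<Longrightarrow> a i \<bullet> f = 0" "s0 \<bullet> f < 0"
  proof (cases "s0 \<bullet> e < 0")
    case False
    have minus: "s \<bullet> (- e) = - (s \<bullet> e)" if "s \<in> S" for s
      using that e(1) S by (intro scalar_prod_uminus_right) auto
    show thesis
      by (rule that[of "- e"]) (use False e s0 ad minus in auto)
  qed (use e that in blast)
  obtain s t where s: "s \<in> S" "s \<bullet> f < 0" "s \<bullet> (y + t \<cdot>\<^sub>v f) = 1"
    and feas: "\<forall>s'\<in>S. 1 \<le> s' \<bullet> (y + t \<cdot>\<^sub>v f)"
    using exists_tight_on_ray[OF assms(1) S y(1) f(1) y(2)[rule_format] s0(1) f(3)] .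
  have tight: "a i \<bullet> (y + t \<cdot>\<^sub>v f) = 1" if "i < k" for i
    using that ad f(1,2) y(1) S by (subst scalar_prod_add_distrib[of _ m]) auto
  show ?case
  proof (intro exI conjI)
    show "y + t \<cdot>\<^sub>v f \<in> carrier_vec m"
      using y(1) f(1) by simp
    show "\<forall>i<Suc k. (a(k := s)) i \<in> S \<and> (d(k := f)) i \<in> carrier_vec m \<and>
        (a(k := s)) i \<bullet> (y + t \<cdot>\<^sub>v f) = 1 \<and> (a(k := s)) i \<bullet> (d(k := f)) i \<noteq> 0"
      using f(1) s tight ad by (simp add: less_Suc_eq)
    show "\<forall>i j. i < j \<longrightarrow> j < Suc k \<longrightarrow> (a(k := s)) i \<bullet> (d(k := f)) j = 0"
      using f(2) tri by (simp add: less_Suc_eq)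
  qed (fact feas)
qed

lemma exists_small_integral_solution:
  fixes S :: "'a :: linordered_field vec set"
  assumes "finite S" and S: "S \<subseteq> carrier_vec m" and "y0 \<in> carrier_vec m"
    and "\<And>s. s \<in> S \<Longrightarrow> 1 \<le> s \<bullet> y0"
    and "\<And>d. d \<in> carrier_vec m \<Longrightarrow> (\<And>s. s \<in> S \<Longrightarrow> s \<bullet> d = 0) \<Longrightarrow> d = 0\<^sub>v m"
    and entry: "\<And>s i. s \<in> S \<Longrightarrow> i < m \<Longrightarrow> s $ i \<in> \<int> \<and> \<bar>s $ i\<bar> \<le> 1"
  obtains z where "z \<in> carrier_vec m" "\<And>s. s \<in> S \<Longrightarrow> 1 \<le> s \<bullet> z"
    "\<And>i. i < m \<Longrightarrow> z $ i \<in> \<int> \<and> \<bar>z $ i\<bar> \<le> fact m"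
proof -
  obtain y a d where y: "y \<in> carrier_vec m" "\<forall>s\<in>S. 1 \<le> s \<bullet> y"
    and ad: "\<forall>i<m. a i \<in> S \<and> d i \<in> carrier_vec m \<and> a i \<bullet> y = 1 \<and> a i \<bullet> d i \<noteq> 0"
    and tri: "\<forall>i j. i < j \<longrightarrow> j < m \<longrightarrow> a i \<bullet> d j = 0"
    using exists_tight_triangular_system[OF assms(1-5) order.refl] by blast
  define M where "M = mat_of_rows m (map a [0..<m])"
  define D where "D = mat_of_cols m (map d [0..<m])"
  have M: "M \<in> carrier_mat m m" and D: "D \<in> carrier_mat m m"
    by (simp_all add: M_def D_def mat_of_rows_def mat_of_cols_def)
  have row: "row M i = a i" if "i < m" for i
    unfolding M_def using that ad S by (subst mat_of_rows_row) auto
  have col: "col D i = d i" if "i < m" for i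
    unfolding D_def using that ad by (subst col_mat_of_cols) auto
  have MD: "(M * D) $$ (i, j) = a i \<bullet> d j" if "i < m" "j < m" for i j
    using that M D row col by simp
  have "det (M * D) = prod_list (diag_mat (M * D))"
    by (rule det_lower_triangular[of m]) (use M D MD tri in auto)
  also have "\<dots> \<noteq> 0"
    using ad M D MD by (auto simp: prod_list_zero_iff diag_mat_def)
  finally have det: "det M \<noteq> 0"
    using det_mult[OF M D] by auto
  have entryM: "M $$ (i, j) \<in> \<int> \<and> \<bar>M $$ (i, j)\<bar> \<le> 1" if "i < m" "j < m" for i j
  proof -
    have "M $$ (i, j) = a i $ j"
      using that row M by (metis carrier_matD index_row(1))
    with that ad entry show ?thesis by simp
  qed
  have sol: "M *\<^sub>v y = vec m (\<lambda>_. 1)"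
    by (rule eq_vecI) (use M row ad in auto)
  have det_int: "det M \<in> \<int>"
    using det_in_Ints[OF M] entryM by blast
  then have "1 \<le> \<bar>det M\<bar>"
    using det by (rule Ints_nonzero_abs_ge1)
  show thesis
  proof (rule that[of "\<bar>det M\<bar> \<cdot>\<^sub>v y"])
    show "\<bar>det M\<bar> \<cdot>\<^sub>v y \<in> carrier_vec m"
      using y by simp
    show "1 \<le> s \<bullet> (\<bar>det M\<bar> \<cdot>\<^sub>v y)" if "s \<in> S" for s
    proof -
      have "1 * 1 \<le> \<bar>det M\<bar> * (s \<bullet> y)"
        using that y(2) \<open>1 \<le> \<bar>det M\<bar>\<close> by (intro mult_mono) auto
      then show ?thesis
        using that S y(1) by (subst scalar_prod_smult_right) auto
    qed
    show "(\<bar>det M\<bar> \<cdot>\<^sub>v y) $ i \<in> \<int> \<and> \<bar>(\<bar>det M\<bar> \<cdot>\<^sub>v y) $ i\<bar> \<le> fact m" if "i < m" for i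
      using det_smult_solution_bound[OF M y(1) entryM sol that] that y(1)
      by (cases "0 \<le> det M") (auto simp: abs_mult minus_in_Ints_iff)
  qed
qed

lemma threshold_fun_iff:
  assumes "X \<in> carrier_vec n"
  shows "threshold_fun w b X \<longleftrightarrow> b \<le> (\<Sum>i<n. w $ i * of_bool (X $ i))"
  using assms by (simp add: threshold_fun_def bits_def scalar_prod_def atLeast0LessThan)

lemma exists_small_weights:
  assumes "linear_threshold_function n f"
  obtains w b where "w \<in> carrier_vec n" "\<And>X. X \<in> carrier_vec n \<Longrightarrow> f X = threshold_fun w b X"
    "\<And>i. i < n \<Longrightarrow> \<bar>w $ i\<bar> \<le> fact (Suc n)"
proof -
  obtain w0 b0 where f: "\<And>X. X \<in> carrier_vec n \<Longrightarrow> f X = threshold_fun w0 b0 X"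
    using assms unfolding linear_threshold_function_def by blast
  define r :: "bool vec \<Rightarrow> rat vec" where
    "r X = vec (Suc n) (\<lambda>i. (if f X then 1 else - 1) * (if i < n then of_bool (X $ i) else - 1))" for X
  have dot: "r X \<bullet> y = (if f X then 1 else - 1) * ((\<Sum>i<n. y $ i * of_bool (X $ i)) - y $ n)"
    if "y \<in> carrier_vec (Suc n)" for X y
    using that by (simp add: scalar_prod_def r_def atLeast0LessThan sum_negf mult.commute)
  define y0 :: "rat vec" where
    "y0 = vec (Suc n) (\<lambda>i. of_int (if i < n then 2 * w0 $ i else 2 * b0 - 1))"
  have "finite (carrier_vec n :: bool vec set)"
  proof -
    have "carrier_vec n \<subseteq> vec_of_list ` {xs :: bool list. set xs \<subseteq> UNIV \<and> length xs = n}"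
      by (auto intro!: image_eqI[of _ _ "list_of_vec _"] simp: vec_list)
    then show ?thesis
      using finite_lists_length_eq[of "UNIV :: bool set" n] finite_surj by auto
  qed
  then have fin: "finite (r ` carrier_vec n)"
    by simp
  have feas: "1 \<le> s \<bullet> y0" if s: "s \<in> r ` carrier_vec n" for s
  proof -
    obtain X where X: "X \<in> carrier_vec n" "s = r X"
      using s by blast
    let ?v = "\<Sum>i<n. w0 $ i * of_bool (X $ i)"
    have "(\<Sum>i<n. y0 $ i * of_bool (X $ i)) = of_int (2 * ?v)"
      unfolding sum_distrib_left of_int_sum by (rule sum.cong) (auto simp: y0_def)
    then have "(\<Sum>i<n. y0 $ i * of_bool (X $ i)) - y0 $ n = of_int (2 * (?v - b0) + 1)"
      by (simp add: y0_def)
    then have "s \<bullet> y0 = of_int ((if f X then 1 else - 1) * (2 * (?v - b0) + 1))"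
      unfolding X(2) by (subst dot) (auto simp: y0_def)
    moreover have "1 \<le> (if f X then 1 else - 1) * (2 * (?v - b0) + 1)"
      using f[OF X(1)] threshold_fun_iff[OF X(1), of w0 b0] by auto
    ultimately show ?thesis
      by (simp only: of_int_1_le_iff)
  qed
  have span: "d = 0\<^sub>v (Suc n)"
    if d: "d \<in> carrier_vec (Suc n)" and orth: "\<And>s. s \<in> r ` carrier_vec n \<Longrightarrow> s \<bullet> d = 0" for d
  proof -
    have zero: "(\<Sum>i<n. d $ i * of_bool (X $ i)) = d $ n" if "X \<in> carrier_vec n" for X
      using orth[of "r X"] dot[OF d, of X] that by (auto split: if_splits)
    have dn: "d $ n = 0"
      using zero[of "vec n (\<lambda>_. False)"] by simp
    have "d $ i = 0" if "i < n" for i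
    proof -
      have "(\<Sum>j<n. d $ j * of_bool (vec n (\<lambda>j. j = i) $ j)) = (\<Sum>j<n. if i = j then d $ j else 0)"
        by (rule sum.cong) auto
      then show ?thesis
        using zero[of "vec n (\<lambda>j. j = i)"] that dn by simp
    qed
    then show ?thesis
      using d dn by (intro eq_vecI) (auto simp: less_Suc_eq)
  qed
  obtain z where z: "z \<in> carrier_vec (Suc n)" "\<And>s. s \<in> r ` carrier_vec n \<Longrightarrow> 1 \<le> s \<bullet> z"
    and zb: "\<And>i. i < Suc n \<Longrightarrow> z $ i \<in> \<int> \<and> \<bar>z $ i\<bar> \<le> fact (Suc n)"
    by (rule exists_small_integral_solution[OF fin _ _ feas span])
      (auto simp: r_def y0_def)
  define w where "w = vec n (\<lambda>i. \<lfloor>z $ i\<rfloor>)"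
  have zi: "z $ i = of_int \<lfloor>z $ i\<rfloor>" if "i < Suc n" for i
    using zb[OF that] by (metis Ints_cases floor_of_int)
  show thesis
  proof (rule that[of w "\<lfloor>z $ n\<rfloor>"])
    show "w \<in> carrier_vec n"
      by (simp add: w_def)
  next
    fix X :: "bool vec" assume X: "X \<in> carrier_vec n"
    let ?v = "\<Sum>i<n. w $ i * of_bool (X $ i)"
    have "(\<Sum>i<n. z $ i * of_bool (X $ i)) = of_int ?v"
      using zi by (auto simp: w_def intro!: sum.cong)
    then have "r X \<bullet> z = of_int ((if f X then 1 else - 1) * (?v - \<lfloor>z $ n\<rfloor>))"
      unfolding dot[OF z(1)] using zi[of n] by simp
    with z(2)[OF imageI[OF X]] have "1 \<le> (if f X then 1 else - 1) * (?v - \<lfloor>z $ n\<rfloor>)"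
      by (simp only: of_int_1_le_iff)
    then show "f X = threshold_fun w \<lfloor>z $ n\<rfloor> X"
      unfolding threshold_fun_iff[OF X] by (auto split: if_splits)
  next
    fix i assume i: "i < n"
    then have "rat_of_int \<bar>\<lfloor>z $ i\<rfloor>\<bar> \<le> of_int (fact (Suc n))"
      using zb[of i] zi[of i] by (metis less_SucI of_int_abs of_int_fact)
    then show "\<bar>w $ i\<bar> \<le> fact (Suc n)"
      using i by (simp only: of_int_le_iff w_def index_vec)
  qed
qed

lemma exists_pivotal_coordinate:
  assumes "\<not> f constant_on (carrier_vec n :: bool vec set)"
  obtains X i where "X \<in> carrier_vec n" "i < n"
    "f (vec n (\<lambda>j. if j = i then False else X $ j)) \<noteq> f (vec n (\<lambda>j. if j = i then True else X $ j))"
proof (rule ccontr)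
  assume "\<not> thesis"
  with that have no: "f (vec n (\<lambda>j. if j = i then False else X $ j)) =
      f (vec n (\<lambda>j. if j = i then True else X $ j))" if "X \<in> carrier_vec n" "i < n" for X i
    using that by blast
  have flip: "f (vec n (\<lambda>j. if j = i then c else X $ j)) = f X" if "X \<in> carrier_vec n" "i < n" for X i c
  proof -
    have X: "X = vec n (\<lambda>j. if j = i then X $ i else X $ j)"
      using that by (intro eq_vecI) auto
    have "f (vec n (\<lambda>j. if j = i then c else X $ j)) = f (vec n (\<lambda>j. if j = i then X $ i else X $ j))"
      using no[OF that] by (cases c; cases "X $ i") (simp_all only:)
    with X show ?thesis by simp
  qed
  have "f X = f Y" if X: "X \<in> carrier_vec n" and Y: "Y \<in> carrier_vec n" for X Y
  proof -
    define Z where "Z k = vec n (\<lambda>j. if j < k then Y $ j else X $ j)" for k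
    have "f (Z k) = f X" if "k \<le> n" for k
      using that
    proof (induction k)
      case 0
      have "Z 0 = X"
        using X by (intro eq_vecI) (auto simp: Z_def)
      then show ?case by simp
    next
      case (Suc k)
      have "Z (Suc k) = vec n (\<lambda>j. if j = k then Y $ k else Z k $ j)"
        by (intro eq_vecI) (auto simp: Z_def less_Suc_eq)
      then show ?case
        using flip[of "Z k" k "Y $ k"] Suc by (simp add: Z_def)
    qed
    moreover have "Z n = Y"
      using Y by (intro eq_vecI) (auto simp: Z_def)
    ultimately show ?thesis by force
  qed
  with assms show False
    unfolding constant_on_def by metis
qed

lemma res_fraction_le:
  fixes a b :: int and W :: real
  assumes "b \<noteq> 0" "1 \<le> W" "\<bar>real_of_int a\<bar> \<le> 4 * W\<^sup>2" "\<bar>real_of_int b\<bar> \<le> 4 * W\<^sup>2"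
  shows "real_of_int (res (of_int a / of_int b)) \<le> 2 * log 2 W + 4"
proof -
  obtain c d where cd: "quotient_of (of_int a / of_int b) = (c, d)"
    by fastforce
  have d: "d > 0" and "coprime c d"
    using quotient_of_denom_pos[OF cd] quotient_of_coprime[OF cd] by auto
  have "of_int a / of_int b = (of_int c / of_int d :: rat)"
    using quotient_of_div[OF cd] .
  then have "rat_of_int (a * d) = of_int (c * b)"
    using assms(1) d by (simp add: field_simps)
  then have eq: "a * d = c * b"
    by (simp only: of_int_eq_iff)
  then have "d dvd b"
    using \<open>coprime c d\<close> by (metis coprime_commute coprime_dvd_mult_right_iff dvd_triv_right)
  then obtain k where k: "b = d * k" ..
  with assms(1) have "k \<noteq> 0" by auto
  have "a = c * k"
    using eq k d by (simp add: mult.left_commute mult.commute)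
  have "1 \<le> \<bar>k\<bar>"
    using \<open>k \<noteq> 0\<close> by simp
  then have "\<bar>c\<bar> \<le> \<bar>a\<bar>" "\<bar>d\<bar> \<le> \<bar>b\<bar>"
    using mult_left_mono[of 1 "\<bar>k\<bar>" "\<bar>c\<bar>"] mult_left_mono[of 1 "\<bar>k\<bar>" "\<bar>d\<bar>"]
    by (simp_all add: k \<open>a = c * k\<close> abs_mult)
  then have cd_le: "\<bar>real_of_int c\<bar> \<le> \<bar>real_of_int a\<bar>" "\<bar>real_of_int d\<bar> \<le> \<bar>real_of_int b\<bar>"
    by (simp_all only: of_int_abs[symmetric] of_int_le_iff)
  have "1 \<le> W\<^sup>2"
    using assms(2) by (simp add: one_le_power)
  have le: "log 2 \<bar>real_of_int (e + 1)\<bar> \<le> 2 * log 2 W + 3" if "\<bar>real_of_int e\<bar> \<le> 4 * W\<^sup>2" for e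
  proof (cases "e = - 1")
    case True
    then show ?thesis using assms(2) by (simp add: log_def)
  next
    case False
    have "log 2 \<bar>real_of_int (e + 1)\<bar> \<le> log 2 (2 ^ 3 * W\<^sup>2)"
      using that \<open>1 \<le> W\<^sup>2\<close> False by (intro log_mono) auto
    also have "\<dots> = 2 * log 2 W + 3"
      using assms(2) by (simp add: log_mult log_nat_power del: power_numeral)
    finally show ?thesis .
  qed
  have "max (log 2 \<bar>real_of_int (c + 1)\<bar>) (log 2 \<bar>real_of_int (d + 1)\<bar>) \<le> 2 * log 2 W + 3"
    using le[OF order.trans[OF cd_le(1) assms(3)]] le[OF order.trans[OF cd_le(2) assms(4)]]
    by (rule max.boundedI)
  then show ?thesis
    using of_int_ceiling_le_add_one[of "max (log 2 \<bar>real_of_int (c + 1)\<bar>) (log 2 \<bar>real_of_int (d + 1)\<bar>)"]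
    unfolding res_def cd prod.case by linarith
qed

lemma euclid_dist_less_iff:
  assumes "dim_vec x = n"
  shows "euclid_dist x p < euclid_dist x q \<longleftrightarrow>
    (\<Sum>i<n. (x $ i - p $ i)\<^sup>2) < (\<Sum>i<n. (x $ i - q $ i)\<^sup>2)"
  using assms by (simp add: euclid_dist_def L2_set_def)

lemma two_anchors_of_midpoint:
  fixes m :: "nat \<Rightarrow> rat" and w :: "int vec"
  assumes m: "(\<Sum>i<n. of_int (w $ i) * m i) = of_int b - 1 / 2"
    and f: "\<And>X. X \<in> carrier_vec n \<Longrightarrow> f X = threshold_fun w b X"
    and i: "i < n" "w $ i \<noteq> 0"
    and bound: "\<And>j. j < n \<Longrightarrow> real_of_int (res (m j + of_int (w $ j))) \<le> K \<and>
      real_of_int (res (m j - of_int (w $ j))) \<le> K"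
  shows "\<exists>P N A. nn_representation n f P N \<and> card (P \<union> N) = 2 \<and> anchor_matrix n P N A \<and>
    real_of_int (res_mat A) \<le> K"
proof -
  define p q where "p = vec n (\<lambda>j. m j + of_int (w $ j))" and "q = vec n (\<lambda>j. m j - of_int (w $ j))"
  define p' q' where "p' = map_vec real_of_rat p" and "q' = map_vec real_of_rat q"
  define A where "A = mat_of_rows n [p, q]"
  have "p' \<noteq> q'"
  proof
    assume "p' = q'"
    then have "p' $ i = q' $ i" by simp
    with i show False by (simp add: p'_def q'_def p_def q_def)
  qed
  have mid: "(\<Sum>j<n. real_of_int (w $ j) * real_of_rat (m j)) = of_int b - 1 / 2"
    using arg_cong[OF m, of real_of_rat]
    by (simp add: of_rat_sum of_rat_mult of_rat_diff of_rat_divide)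
  have diff: "(\<Sum>j<n. (bits X $ j - q' $ j)\<^sup>2) - (\<Sum>j<n. (bits X $ j - p' $ j)\<^sup>2) =
      4 * (of_int (\<Sum>j<n. w $ j * of_bool (X $ j)) - of_int b) + 2"
    if "X \<in> carrier_vec n" for X
  proof -
    have "(\<Sum>j<n. (bits X $ j - q' $ j)\<^sup>2) - (\<Sum>j<n. (bits X $ j - p' $ j)\<^sup>2) =
      (\<Sum>j<n. 4 * (of_int (w $ j) * of_bool (X $ j)) - 4 * (of_int (w $ j) * real_of_rat (m j)))"
      unfolding sum_subtractf[symmetric]
      by (rule sum.cong) (use that in \<open>auto simp: bits_def p'_def q'_def p_def q_def of_rat_add
          of_rat_diff power2_eq_square algebra_simps\<close>)
    also have "\<dots> = 4 * (\<Sum>j<n. of_int (w $ j) * of_bool (X $ j)) - 4 * (of_int b - 1 / 2)"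
      unfolding sum_subtractf sum_distrib_left[symmetric] mid ..
    finally show ?thesis
      by simp
  qed
  have near: "if f X then euclid_dist (bits X) p' < euclid_dist (bits X) q'
      else euclid_dist (bits X) q' < euclid_dist (bits X) p'" if X: "X \<in> carrier_vec n" for X
  proof -
    let ?v = "\<Sum>j<n. w $ j * of_bool (X $ j)"
    have "dim_vec (bits X :: real vec) = n"
      using X by (simp add: bits_def)
    note iff = euclid_dist_less_iff[OF this]
    show ?thesis
    proof (cases "b \<le> ?v")
      case True
      then have "real_of_int b \<le> of_int ?v" by (simp only: of_int_le_iff)
      then show ?thesis
        using True diff[OF X] f[OF X] by (simp add: iff threshold_fun_iff[OF X])
    next
      case False
      then have "?v + 1 \<le> b" by simp
      then have "real_of_int (?v + 1) \<le> of_int b" by (simp only: of_int_le_iff)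
      then show ?thesis
        using False diff[OF X] f[OF X] by (simp add: iff threshold_fun_iff[OF X])
    qed
  qed
  have "p' \<in> carrier_vec n" "q' \<in> carrier_vec n"
    by (simp_all add: p'_def q'_def p_def q_def)
  then have "nn_representation n f {p'} {q'}"
    unfolding nn_representation_def using near \<open>p' \<noteq> q'\<close> by simp
  moreover have card: "card ({p'} \<union> {q'}) = 2"
    using \<open>p' \<noteq> q'\<close> by simp
  moreover have "anchor_matrix n {p'} {q'} A"
  proof -
    have "map_mat real_of_rat A = mat_of_rows n [p', q']"
      by (rule eq_matI) (auto simp: A_def p'_def q'_def p_def q_def mat_of_rows_def less_Suc_eq)
    then have "rows (map_mat real_of_rat A) = [p', q']"
      by (simp add: p'_def q'_def p_def q_def)
    then show ?thesis
      using card by (auto simp: anchor_matrix_def A_def mat_of_rows_def)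
  qed
  moreover have "real_of_int (res_mat A) \<le> K"
  proof -
    have "finite (res ` elements_mat A)" "res ` elements_mat A \<noteq> {}"
      using i by (auto simp: elements_mat_def A_def mat_of_rows_def)
    then have "res_mat A \<in> res ` elements_mat A"
      unfolding res_mat_def by (rule Max_in)
    moreover have "dim_row A = 2" "dim_col A = n"
      by (simp_all add: A_def mat_of_rows_def)
    ultimately obtain r j where "r < 2" "j < n" "res_mat A = res (A $$ (r, j))"
      by (metis elements_matD imageE)
    then show ?thesis
      using bound[of j] by (auto simp: A_def mat_of_rows_def p_def q_def less_2_cases_iff)
  qed
  ultimately show ?thesis by blast
qed

lemma two_anchor_representation:
  fixes W :: real
  assumes "\<not> f constant_on carrier_vec n"
    and f: "\<And>X. X \<in> carrier_vec n \<Longrightarrow> f X = threshold_fun w b X"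
    and W: "1 \<le> W" and wW: "\<And>i. i < n \<Longrightarrow> \<bar>real_of_int (w $ i)\<bar> \<le> W"
  shows "\<exists>P N A. nn_representation n f P N \<and> card (P \<union> N) = 2 \<and> anchor_matrix n P N A \<and>
    real_of_int (res_mat A) \<le> 2 * log 2 W + 4"
proof -
  obtain X i where X: "X \<in> carrier_vec n" and i: "i < n" and
    piv: "f (vec n (\<lambda>j. if j = i then False else X $ j)) \<noteq> f (vec n (\<lambda>j. if j = i then True else X $ j))"
    using exists_pivotal_coordinate[OF assms(1)] .
  define base where "base = (\<Sum>j\<in>{..<n} - {i}. w $ j * of_bool (X $ j))"
  define s where "s = 2 * (b - base) - 1"
  have val: "f (vec n (\<lambda>j. if j = i then c else X $ j)) \<longleftrightarrow> b \<le> base + w $ i * of_bool c" for c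
  proof -
    have "(\<Sum>j<n. w $ j * of_bool (vec n (\<lambda>j. if j = i then c else X $ j) $ j)) =
      w $ i * of_bool c + (\<Sum>j\<in>{..<n} - {i}. w $ j * of_bool (X $ j))"
      using i by (subst sum.remove[of _ i]) (auto intro!: sum.cong)
    then show ?thesis
      using f[of "vec n (\<lambda>j. if j = i then c else X $ j)"]
        threshold_fun_iff[of "vec n (\<lambda>j. if j = i then c else X $ j)" n w b]
      by (simp add: base_def add.commute)
  qed
  have "w $ i \<noteq> 0" and s: "\<bar>s\<bar> \<le> 2 * \<bar>w $ i\<bar>"
    using piv unfolding val s_def by auto
  define m :: "nat \<Rightarrow> rat" where
    "m j = (if j = i then of_int s / of_int (2 * w $ i) else of_bool (X $ j))" for j
  have "(\<Sum>j<n. of_int (w $ j) * m j) = of_int (w $ i) * m i + of_int base"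
    using i by (subst sum.remove[of _ i]) (auto simp: base_def m_def intro!: sum.cong)
  also have "\<dots> = of_int b - 1 / 2"
    using \<open>w $ i \<noteq> 0\<close> by (simp add: m_def s_def field_simps)
  finally have mid: "(\<Sum>j<n. of_int (w $ j) * m j) = of_int b - 1 / 2" .
  have "W \<le> W\<^sup>2" "1 \<le> W\<^sup>2"
    using W by (simp_all add: self_le_power one_le_power)
  have bound: "real_of_int (res (m j + of_int v)) \<le> 2 * log 2 W + 4"
    if j: "j < n" and v: "v = w $ j \<or> v = - w $ j" for j v
  proof (cases "j = i")
    case True
    have "m j + of_int v = of_int (s + 2 * w $ i * v) / of_int (2 * w $ i)"
      using True \<open>w $ i \<noteq> 0\<close> by (simp add: m_def field_simps)
    moreover have "\<bar>real_of_int (s + 2 * w $ i * v)\<bar> \<le> 4 * W\<^sup>2"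
    proof -
      have "\<bar>real_of_int s\<bar> \<le> 2 * W"
        using s wW[OF i] by linarith
      moreover have "\<bar>real_of_int (w $ i * v)\<bar> \<le> W * W"
        using v True wW[OF i] W by (auto simp: abs_mult intro!: mult_mono)
      ultimately show ?thesis
        using \<open>W \<le> W\<^sup>2\<close> by (simp add: power2_eq_square)
    qed
    moreover have "\<bar>real_of_int (2 * w $ i)\<bar> \<le> 4 * W\<^sup>2"
      using wW[OF i] \<open>W \<le> W\<^sup>2\<close> W by (simp add: abs_mult)
    ultimately show ?thesis
      using \<open>w $ i \<noteq> 0\<close> W by (simp only:) (rule res_fraction_le, auto)
  next
    case False
    have "m j + of_int v = of_int (of_bool (X $ j) + v) / of_int 1"
      using False by (simp add: m_def)
    moreover have "\<bar>real_of_int (of_bool (X $ j) + v)\<bar> \<le> 4 * W\<^sup>2"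
      using v wW[OF j] \<open>W \<le> W\<^sup>2\<close> W by (cases "X $ j") auto
    moreover have "\<bar>real_of_int 1\<bar> \<le> 4 * W\<^sup>2"
      using \<open>1 \<le> W\<^sup>2\<close> by simp
    ultimately show ?thesis
      using W by (simp only:) (rule res_fraction_le, auto)
  qed
  show ?thesis
    using two_anchors_of_midpoint[OF mid f i \<open>w $ i \<noteq> 0\<close>, of "2 * log 2 W + 4"]
      bound[of _ "w $ _"] bound[of _ "- w $ _"] by auto
qed

lemma res_of_int: "res (of_int v) = \<lceil>max (log 2 \<bar>real_of_int (v + 1)\<bar>) 1\<rceil>"
  by (simp add: res_def)

lemma res_of_int_ge_1: "1 \<le> res (of_int v)"
  unfolding res_of_int by linarith

lemma abs_le_powr_res: "\<bar>real_of_int v\<bar> \<le> 2 powr (of_int (res (of_int v)) + 1)"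
proof -
  have "\<bar>real_of_int (v + 1)\<bar> \<le> 2 powr of_int (res (of_int v))"
  proof (cases "v = - 1")
    case False
    have "log 2 \<bar>real_of_int (v + 1)\<bar> \<le> of_int (res (of_int v))"
      unfolding res_of_int by linarith
    with False show ?thesis
      by (subst (asm) log_le_iff) auto
  qed simp
  moreover have "1 \<le> 2 powr real_of_int (res (of_int v))"
    using res_of_int_ge_1[of v] by (intro ge_one_powr_ge_zero) auto
  ultimately show ?thesis
    by (simp add: powr_add)
qed

lemma two_anchor_representation_res_vec:
  assumes w: "w \<in> carrier_vec n" and "\<not> threshold_fun w b constant_on carrier_vec n"
  shows "\<exists>P N A. nn_representation n (threshold_fun w b) P N \<and> card (P \<union> N) = 2 \<and>
    anchor_matrix n P N A \<and>
    real_of_int (res_mat A) \<le> 8 * real_of_int (res_vec (map_vec rat_of_int w))"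
proof -
  define r where "r = res_vec (map_vec rat_of_int w)"
  have le: "res (of_int (w $ i)) \<le> r" if "i < n" for i
    unfolding r_def res_vec_def using that w by (intro Max_ge) (auto simp: vec_set_def)
  obtain i where "i < n"
    using exists_pivotal_coordinate[OF assms(2)] .
  with le[of i] res_of_int_ge_1[of "w $ i"] have "1 \<le> r"
    by linarith
  have "\<bar>real_of_int (w $ i)\<bar> \<le> 2 powr (of_int r + 1)" if "i < n" for i
    using le[OF that] by (intro order.trans[OF abs_le_powr_res] powr_mono) auto
  moreover have "1 \<le> 2 powr (real_of_int r + 1)"
    using \<open>1 \<le> r\<close> by (intro ge_one_powr_ge_zero) auto
  ultimately obtain P N A where
    "nn_representation n (threshold_fun w b) P N" "card (P \<union> N) = 2" "anchor_matrix n P N A"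
    "real_of_int (res_mat A) \<le> 2 * log 2 (2 powr (of_int r + 1)) + 4"
    using two_anchor_representation[OF assms(2) refl, of "2 powr (of_int r + 1)"] by blast
  moreover from this(4) have "real_of_int (res_mat A) \<le> 8 * of_int r"
    using \<open>1 \<le> r\<close> by simp
  ultimately show ?thesis
    unfolding r_def by blast
qed

lemma two_anchor_representation_log:
  assumes "linear_threshold_function n f" and "\<not> f constant_on carrier_vec n"
  shows "\<exists>P N A. nn_representation n f P N \<and> card (P \<union> N) = 2 \<and> anchor_matrix n P N A \<and>
    real_of_int (res_mat A) \<le> 2 * (real n + 1) * log 2 (real n + 1) + 4"
proof -
  obtain w b where f: "\<And>X. X \<in> carrier_vec n \<Longrightarrow> f X = threshold_fun w b X"
    and w: "\<And>i. i < n \<Longrightarrow> \<bar>w $ i\<bar> \<le> fact (Suc n)"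
    using exists_small_weights[OF assms(1)] by metis
  have "\<bar>real_of_int (w $ i)\<bar> \<le> fact (Suc n)" if "i < n" for i
    using w[OF that] by (metis of_int_abs of_int_fact of_int_le_iff)
  then obtain P N A where PNA: "nn_representation n f P N" "card (P \<union> N) = 2" "anchor_matrix n P N A"
    and res: "real_of_int (res_mat A) \<le> 2 * log 2 (fact (Suc n)) + 4"
    using two_anchor_representation[OF assms(2) f fact_ge_1] by blast
  have "log 2 (fact (Suc n)) \<le> log 2 (real (Suc n ^ Suc n))"
    by (intro log_mono) (use fact_le_power[of "Suc n", where 'a = real] in auto)
  also have "\<dots> = (real n + 1) * log 2 (real n + 1)"
    by (simp add: log_nat_power add.commute del: power_Suc)
  finally have "real_of_int (res_mat A) \<le> 2 * (real n + 1) * log 2 (real n + 1) + 4"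
    using res by linarith
  with PNA show ?thesis by blast
qed

theorem theorem6:
  shows "(\<exists>C :: real. \<forall>n. \<forall>w \<in> carrier_vec n. \<forall>b.
            \<not> threshold_fun w b constant_on carrier_vec n \<longrightarrow>
            (\<exists>P N A. nn_representation n (threshold_fun w b) P N \<and> card (P \<union> N) = 2 \<and>
               anchor_matrix n P N A \<and>
               real_of_int (res_mat A) \<le> C * real_of_int (res_vec (map_vec rat_of_int w))))
       \<and> (\<exists>R :: nat \<Rightarrow> real. R \<in> O(\<lambda>n. real n * log 2 (real n)) \<and>
            (\<forall>n f. linear_threshold_function n f \<and> \<not> f constant_on carrier_vec n \<longrightarrow>
               (\<exists>P N A. nn_representation n f P N \<and> card (P \<union> N) = 2 \<and>
                  anchor_matrix n P N A \<and> real_of_int (res_mat A) \<le> R n)))"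
proof
  have "(\<lambda>n. 2 * (real n + 1) * log 2 (real n + 1) + 4) \<in> O(\<lambda>n. real n * log 2 (real n))"
  proof (rule bigoI[of _ 12], unfold eventually_sequentially, intro exI allI impI)
    fix n :: nat assume n: "2 \<le> n"
    have log1: "1 \<le> log 2 (real n)"
      using n by (simp add: le_log_iff)
    have "n + 1 \<le> n ^ 2"
      using n mult_le_mono1[of 2 n n] unfolding power2_eq_square by linarith
    then have "real (n + 1) \<le> real (n ^ 2)"
      by (simp only: of_nat_le_iff)
    then have "log 2 (real (n + 1)) \<le> log 2 (real (n ^ 2))"
      by (intro log_mono) simp_all
    also have "\<dots> = 2 * log 2 (real n)"
      using n by (simp add: log_nat_power)
    finally have "2 * (real n + 1) * log 2 (real n + 1) \<le> 2 * (2 * real n) * (2 * log 2 (real n))"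
      using n by (intro mult_mono) (auto simp: add.commute)
    moreover have "2 * 1 \<le> real n * log 2 (real n)"
      using n log1 by (intro mult_mono) auto
    ultimately have "2 * (real n + 1) * log 2 (real n + 1) + 4 \<le> 12 * (real n * log 2 (real n))"
      by simp
    then show "norm (2 * (real n + 1) * log 2 (real n + 1) + 4) \<le> 12 * norm (real n * log 2 (real n))"
      using log1 by simp
  qed
  then show "\<exists>R :: nat \<Rightarrow> real. R \<in> O(\<lambda>n. real n * log 2 (real n)) \<and>
      (\<forall>n f. linear_threshold_function n f \<and> \<not> f constant_on carrier_vec n \<longrightarrow>
         (\<exists>P N A. nn_representation n f P N \<and> card (P \<union> N) = 2 \<and>
            anchor_matrix n P N A \<and> real_of_int (res_mat A) \<le> R n))"
    using two_anchor_representation_log by blast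
qed (use two_anchor_representation_res_vec in blast)

end
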